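(* Let $X$ be an $\mathcal{SL}$-supermartingale, and let $S\le T$ be bounded stopping times. Then $X_S\ge\mathcal{E}_S(X_T)$ (quasi-surely).
   Context: Let $(\Omega,\mathcal{F})$ be a measurable space with a discrete-time filtration $\{\mathcal{F}_t\}_{t\in\mathbb{N}}$, $\mathbb{N}=\{0,1,2,\dots\}$, such that $\mathcal{F}=\mathcal{F}_\infty=\sigma(\bigcup_t\mathcal{F}_t)$ and $\mathcal{F}_0$ is trivial. $m\mathcal{F}_t$ denotes the $\mathcal{F}_t$-measurable $\mathbb{R}\cup\{\pm\infty\}$-valued functions. $\mathcal{H}$ is a linear space of $\mathcal{F}$-measurable $\mathbb{R}$-valued functions on $\Omega$ containing the constants, such that $X\in\mathcal{H}$ implies $|X|\in\mathcal{H}$ and $I_AX\in\mathcal{H}$ for all $A\in\mathcal{F}$; $\mathcal{H}_t:=\mathcal{H}\cap m\mathcal{F}_t$. $\mathcal{E}$ is an $\mathcal{SL}$-expectation: a family of maps $\mathcal{E}_t:\mathcal{H}\to\mathcal{H}_t$ such that for all $X,Y\in\mathcal{H}$, $s\le t$: (i) $X\ge Y$ implies $\mathcal{E}_t(X)\ge\mathcal{E}_t(Y)$; (ii) $\mathcal{E}_s(Y)=\mathcal{E}_s(\mathcal{E}_t(Y))$; (iii) $\mathcal{E}_t(I_AY)=I_A\mathcal{E}_t(Y)$ for $A\in\mathcal{F}_t$; (iv) $\mathcal{E}_t(Y)=Y$ for $Y\in\mathcal{H}_t$; (v) $\mathcal{E}_t(X+Y)\le\mathcal{E}_t(X)+\mathcal{E}_t(Y)$;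 (vi) $\mathcal{E}_t(\lambda Y)=\lambda^+\mathcal{E}_t(Y)+\lambda^-\mathcal{E}_t(-Y)$ for $\lambda\in\mathcal{H}_t$ with $\lambda Y\in\mathcal{H}$; (vii) if $X_i\in\mathcal{H}$ and $X_i(\omega)\downarrow0$ for every $\omega$, then $\mathcal{E}_0(X_i)\to0$. Write $\mathcal{E}=\mathcal{E}_0$ (real-valued). Such $\mathcal{E}$ has a representation $\mathcal{E}(Y)=\sup_{\theta\in\Theta}E_\theta[Y]$ for a collection $\Theta$ of ($\sigma$-additive) probability measures. A statement holds quasi-surely (q.s.) if it holds outside a set $N$ with $\mathcal{E}(I_N)=0$. $L^1$ is the completion of $\{X\in\mathcal{H}:\mathcal{E}(|X|)<\infty\}$ under $\|X\|_1=\mathcal{E}(|X|)$, modulo equality in $\|\cdot\|_1$; its elements are regarded as $\mathcal{F}$-measurable functions (up to q.s. equality), and each $\mathcal{E}_t$ extends to $L^1$ by $\mathcal{E}_t(X)=\lim\mathcal{E}_t(X_n)$ (limit in $L^1$) for $X_n\to X$ in $L^1$. An $\mathcal{SL}$-supermartingale is a process $X$ with $X_t\in L^1\cap m\mathcal{F}_t$ for all $t$ and $X_s\ge\mathcal{E}_s(X_t)$ for all $s\le t$ (relations in $L^1$ are understood q.s.). For a stopping time $S$, $\mathcal{E}_S(\cdot)(\omega):=\mathcal{E}_{S(\omega)}(\cdot)(\omega)$. *)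

theory Defs
  imports "HOL-Probability.Probability"
begin

text \<open>
  Functions on the sample space are total functions that only matter on \<^term>\<open>space M\<close>; the measure
  carried by \<^term>\<open>M\<close> plays no role. The set \<open>H\<close> and the maps \<open>E t\<close> are the space of
  real-valued functions and the family of conditional expectations. As \<open>E t\<close> takes real values on
  \<open>H\<close>, the restriction to elements with finite expectation of the absolute value is void.
\<close>

locale SL_expectation = filtration "space M" F
  for M :: "'a measure" and F :: "nat \<Rightarrow> 'a measure" +
  fixes H :: "('a \<Rightarrow> real) set" and E :: "nat \<Rightarrow> ('a \<Rightarrow> real) \<Rightarrow> 'a \<Rightarrow> real"
  assumes space_nonempty: "space M \<noteq> {}"
    and sets_eq_sigma: "sets M = sigma_sets (space M) (\<Union>t. sets (F t))"
    and sets_F0_trivial: "sets (F 0) = {{}, space M}"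
    and H_measurable: "H \<subseteq> borel_measurable M"
    and H_const: "(\<lambda>_. c) \<in> H"
    and H_add: "X \<in> H \<Longrightarrow> Y \<in> H \<Longrightarrow> (\<lambda>\<omega>. X \<omega> + Y \<omega>) \<in> H"
    and H_scale: "X \<in> H \<Longrightarrow> (\<lambda>\<omega>. c * X \<omega>) \<in> H"
    and H_abs: "X \<in> H \<Longrightarrow> (\<lambda>\<omega>. \<bar>X \<omega>\<bar>) \<in> H"
    and H_indicator: "X \<in> H \<Longrightarrow> A \<in> sets M \<Longrightarrow> (\<lambda>\<omega>. indicator A \<omega> * X \<omega>) \<in> H"
    and E_closed: "X \<in> H \<Longrightarrow> E t X \<in> H \<inter> borel_measurable (F t)"
    and E_mono: "X \<in> H \<Longrightarrow> Y \<in> H \<Longrightarrow> \<forall>\<omega>\<in>space M. Y \<omega> \<le> X \<omega> \<Longrightarrow>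
      \<forall>\<omega>\<in>space M. E t Y \<omega> \<le> E t X \<omega>"
    and E_tower: "Y \<in> H \<Longrightarrow> s \<le> t \<Longrightarrow> \<forall>\<omega>\<in>space M. E s Y \<omega> = E s (E t Y) \<omega>"
    and E_local: "Y \<in> H \<Longrightarrow> A \<in> sets (F t) \<Longrightarrow>
      \<forall>\<omega>\<in>space M. E t (\<lambda>\<omega>. indicator A \<omega> * Y \<omega>) \<omega> = indicator A \<omega> * E t Y \<omega>"
    and E_id: "Y \<in> H \<inter> borel_measurable (F t) \<Longrightarrow> \<forall>\<omega>\<in>space M. E t Y \<omega> = Y \<omega>"
    and E_subadditive: "X \<in> H \<Longrightarrow> Y \<in> H \<Longrightarrow>
      \<forall>\<omega>\<in>space M. E t (\<lambda>\<omega>. X \<omega> + Y \<omega>) \<omega> \<le> E t X \<omega> + E t Y \<omega>"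
    and E_homogeneous: "l \<in> H \<inter> borel_measurable (F t) \<Longrightarrow> Y \<in> H \<Longrightarrow> (\<lambda>\<omega>. l \<omega> * Y \<omega>) \<in> H \<Longrightarrow>
      \<forall>\<omega>\<in>space M. E t (\<lambda>\<omega>. l \<omega> * Y \<omega>) \<omega> =
        max (l \<omega>) 0 * E t Y \<omega> + max (- l \<omega>) 0 * E t (\<lambda>\<omega>. - Y \<omega>) \<omega>"
    and E_continuous: "(\<And>i. Xs i \<in> H) \<Longrightarrow>
      (\<And>\<omega>. \<omega> \<in> space M \<Longrightarrow> decseq (\<lambda>i. Xs i \<omega>) \<and> (\<lambda>i. Xs i \<omega>) \<longlonglongrightarrow> 0) \<Longrightarrow>
      \<forall>\<omega>\<in>space M. (\<lambda>i. E 0 (Xs i) \<omega>) \<longlonglongrightarrow> (0 :: real)"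
begin

text \<open>\<^term>\<open>E 0 Y\<close> is constant on the sample space, because \<^term>\<open>F 0\<close> is trivial.\<close>

definition expect :: "('a \<Rightarrow> real) \<Rightarrow> real" where
  "expect Y = (THE c. \<forall>\<omega>\<in>space M. E 0 Y \<omega> = c)"

definition quasi_surely :: "('a \<Rightarrow> bool) \<Rightarrow> bool" where
  "quasi_surely P \<longleftrightarrow> (\<exists>N\<in>sets M. expect (indicator N) = 0 \<and> (\<forall>\<omega>\<in>space M - N. P \<omega>))"

text \<open>
  The norm of an arbitrary measurable function. On \<open>H\<close> it is the expectation of the absolute
  value, by monotonicity. If the expectation is the supremum of the linear expectations
  with respect to a family of probability measures, then the norm of \<open>Z\<close> is the supremum of the integrals
  of the absolute value of \<open>Z\<close>, because \<open>H\<close> contains all simple functions.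
\<close>

definition norm1 :: "('a \<Rightarrow> ereal) \<Rightarrow> ereal" where
  "norm1 Z = (SUP Y \<in> {Y \<in> H. \<forall>\<omega>\<in>space M. ereal (Y \<omega>) \<le> \<bar>Z \<omega>\<bar>}. ereal (expect Y))"

definition L1_lim :: "(nat \<Rightarrow> 'a \<Rightarrow> real) \<Rightarrow> ('a \<Rightarrow> ereal) \<Rightarrow> bool" where
  "L1_lim Xs X \<longleftrightarrow> (\<forall>n. Xs n \<in> H) \<and> X \<in> borel_measurable M \<and>
     (\<lambda>n. norm1 (\<lambda>\<omega>. X \<omega> - ereal (Xs n \<omega>))) \<longlonglongrightarrow> 0"

text \<open>
  The completion of \<open>H\<close>, realised as the closure of \<open>H\<close> in the measurable functions. Elements are
  functions rather than equivalence classes; functions at distance zero are those that agree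
  quasi-surely.
\<close>

definition L1 :: "('a \<Rightarrow> ereal) set" where
  "L1 = {X. \<exists>Xs. L1_lim Xs X}"

text \<open>
  The extension of \<^term>\<open>E t\<close> to \<^term>\<open>L1\<close>: a version of the limit, which is determined up to
  quasi-sure equality and does not depend on the approximating sequence.
\<close>

definition cond_expect :: "nat \<Rightarrow> ('a \<Rightarrow> ereal) \<Rightarrow> 'a \<Rightarrow> ereal" where
  "cond_expect t X = (SOME Y. \<exists>Xs. L1_lim Xs X \<and> L1_lim (\<lambda>n. E t (Xs n)) Y)"

definition cond_expect_at :: "('a \<Rightarrow> nat) \<Rightarrow> ('a \<Rightarrow> ereal) \<Rightarrow> 'a \<Rightarrow> ereal" where
  "cond_expect_at S X \<omega> = cond_expect (S \<omega>) X \<omega>"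

definition supermartingale :: "(nat \<Rightarrow> 'a \<Rightarrow> ereal) \<Rightarrow> bool" where
  "supermartingale X \<longleftrightarrow> (\<forall>t. X t \<in> L1 \<inter> borel_measurable (F t)) \<and>
     (\<forall>s t. s \<le> t \<longrightarrow> quasi_surely (\<lambda>\<omega>. X s \<omega> \<ge> cond_expect s (X t) \<omega>))"

end

end

theory Submission
  imports Defs
begin

text \<open>
  Backward induction on \<open>s\<close> shows \<open>E\<^sub>s(X\<^sub>T) \<le> X\<^sub>s\<close> on the event \<open>{s \<le> T}\<close>, which is vacuous once \<open>s\<close> exceeds the
  bound of \<open>T\<close>. On \<open>{T = s}\<close> the supermartingale inequality \<open>E\<^sub>s(X\<^sub>s) \<le> X\<^sub>s\<close> applies; on \<open>{s < T}\<close>,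
  which belongs to \<open>F\<^sub>s\<close>, the tower property and the induction hypothesis give
  \<open>E\<^sub>s(X\<^sub>T) = E\<^sub>s(E\<^sub>s\<^sub>+\<^sub>1(X\<^sub>T)) \<le> E\<^sub>s(X\<^sub>s\<^sub>+\<^sub>1) \<le> X\<^sub>s\<close>. Taking \<open>s = S\<close> finishes the proof. All of this
  takes place in the completion, so one needs the extended conditional expectations to exist, that
  is, completeness of \<open>L1\<close>, and to be monotone locally on events of \<open>F\<^sub>s\<close>. Local monotonicity contains
  the quasi-sure uniqueness of versions.
\<close>

section \<open>Inequalities and null sequences in the extended reals\<close>

text \<open>Triangle inequality through real approximants \<open>u\<close> of \<open>a\<close> and
  \<open>v\<close> of \<open>b\<close>; if \<open>a\<close> or \<open>b\<close> is infinite, so is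
  the right-hand side. It later bounds the excess of one limit over another.\<close>

lemma ereal_gap_bound:
  fixes a b :: ereal and u v r :: real
  assumes "b < a" and "u - v \<le> r"
  shows "a - b \<le> \<bar>a - ereal u\<bar> + \<bar>b - ereal v\<bar> + \<bar>ereal r\<bar>"
  using assms by (cases a; cases b) auto

text \<open>For finite values, \<open>u - v\<close> is at most \<open>(u - a) + (b - v)\<close>
  because \<open>a \<le> b\<close>, and the right-hand side is nonnegative.\<close>

lemma ereal_pos_part_diff_bound:
  fixes a b :: ereal and u v :: real
  assumes "a \<le> b"
  shows "ereal (max (u - v) 0) \<le> \<bar>a - ereal u\<bar> + \<bar>b - ereal v\<bar>"
  using assms by (cases a; cases b) auto

lemma tendsto_add_zero_ereal:
  fixes f g :: "nat \<Rightarrow> ereal"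
  assumes "f \<longlonglongrightarrow> 0" "g \<longlonglongrightarrow> 0"
  shows "(\<lambda>n. f n + g n) \<longlonglongrightarrow> 0"
  using tendsto_add_ereal[OF _ _ assms] by simp

lemma tendsto_cmult_zero_ereal:
  fixes f :: "nat \<Rightarrow> ereal"
  assumes "f \<longlonglongrightarrow> 0"
  shows "(\<lambda>n. ereal c * f n) \<longlonglongrightarrow> 0"
  using tendsto_cmult_ereal[OF _ assms, of "ereal c"] by simp

context SL_expectation
begin

section \<open>Closure properties of \<open>H\<close> and elementary properties of
  \<open>E t\<close>\<close>

lemma sets_F_subset: "sets (F t) \<subseteq> sets M"
  unfolding sets_eq_sigma by (auto intro: sigma_sets.Basic)

lemma H_diff:
  assumes "X \<in> H" "Y \<in> H"
  shows "(\<lambda>\<omega>. X \<omega> - Y \<omega>) \<in> H"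
  using H_add[OF assms(1) H_scale[OF assms(2), of "-1"]] by simp

lemma H_pos_part:
  assumes "X \<in> H"
  shows "(\<lambda>\<omega>. max (X \<omega>) 0) \<in> H"
proof -
  have "(\<lambda>\<omega>. max (X \<omega>) 0) = (\<lambda>\<omega>. (1/2) * (X \<omega> + \<bar>X \<omega>\<bar>))"
    by (auto simp: max_def)
  then show ?thesis
    using H_scale[OF H_add[OF assms H_abs[OF assms]], of "1/2"] by simp
qed

lemma H_sum:
  fixes G :: "nat \<Rightarrow> 'a \<Rightarrow> real"
  assumes "\<And>j. G j \<in> H"
  shows "(\<lambda>\<omega>. \<Sum>j<n. G j \<omega>) \<in> H"
proof (induction n)
  case (Suc n)
  then show ?case
    using H_add[OF Suc assms[of n]] by simp
qed (simp add: H_const)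

lemma H_indicator_const: "A \<in> sets M \<Longrightarrow> indicator A \<in> H"
  using H_indicator[OF H_const[of 1]] by simp

lemma E_in_H: "X \<in> H \<Longrightarrow> E t X \<in> H"
  using E_closed by blast

lemma E_nonneg:
  assumes "Y \<in> H" "\<And>\<omega>. \<omega> \<in> space M \<Longrightarrow> 0 \<le> Y \<omega>" "\<omega> \<in> space M"
  shows "0 \<le> E t Y \<omega>"
proof -
  have "E t (\<lambda>_. 0) \<omega> = 0"
    using E_id[of "\<lambda>_. 0" t] H_const assms(3) by auto
  then show ?thesis
    using E_mono[OF assms(1) H_const[of 0]] assms by metis
qed

text \<open>Subadditivity applied to \<open>X = (X - Y) + Y\<close>.\<close>

lemma E_diff_le:
  assumes "X \<in> H" "Y \<in> H" "\<omega> \<in> space M"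
  shows "E t X \<omega> - E t Y \<omega> \<le> E t (\<lambda>\<omega>. X \<omega> - Y \<omega>) \<omega>"
  using E_subadditive[OF H_diff[OF assms(1,2)] assms(2), of t] assms(3) by force

section \<open>The expectation at time 0 and its countable subadditivity\<close>

text \<open>The level set of \<open>E 0 Y\<close> through \<open>\<omega>\<close> belongs to the
  trivial \<open>F 0\<close> and is nonempty, so it is the whole space. Hence the definite
  description in \<open>expect\<close> is well defined.\<close>

lemma E0_eq_expect:
  assumes "Y \<in> H" "\<omega> \<in> space M"
  shows "E 0 Y \<omega> = expect Y"
proof -
  have const: "E 0 Y \<omega>' = E 0 Y \<omega>" if "\<omega>' \<in> space M" for \<omega>'
  proof -
    have "E 0 Y -` {E 0 Y \<omega>} \<inter> space (F 0) \<in> sets (F 0)"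
      using E_closed[OF assms(1), of 0] by (intro measurable_sets[where A = borel]) auto
    then have "E 0 Y -` {E 0 Y \<omega>} \<inter> space M \<in> {{}, space M}"
      using sets_F0_trivial space_F by simp
    then show ?thesis
      using assms(2) that by blast
  qed
  have "expect Y = E 0 Y \<omega>"
    unfolding expect_def
  proof (rule the_equality)
    show "\<forall>\<omega>'\<in>space M. E 0 Y \<omega>' = E 0 Y \<omega>"
      using const by blast
    show "c = E 0 Y \<omega>" if "\<forall>\<omega>'\<in>space M. E 0 Y \<omega>' = c" for c
      using bspec[OF that assms(2)] by (rule sym)
  qed
  then show ?thesis
    by (rule sym)
qed

lemma expect_mono:
  assumes "X \<in> H" "Y \<in> H" "\<And>\<omega>. \<omega> \<in> space M \<Longrightarrow> Y \<omega> \<le> X \<omega>"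
  shows "expect Y \<le> expect X"
proof -
  obtain \<omega> where "\<omega> \<in> space M" using space_nonempty by blast
  then show ?thesis
    using E_mono[OF assms(1,2), of 0] E0_eq_expect[of X \<omega>] E0_eq_expect[of Y \<omega>] assms by auto
qed

lemma expect_add_le:
  assumes "X \<in> H" "Y \<in> H"
  shows "expect (\<lambda>\<omega>. X \<omega> + Y \<omega>) \<le> expect X + expect Y"
proof -
  obtain \<omega> where \<omega>: "\<omega> \<in> space M" using space_nonempty by blast
  show ?thesis
    using E_subadditive[OF assms, of 0] \<omega> E0_eq_expect[OF assms(1) \<omega>] E0_eq_expect[OF assms(2) \<omega>]
      E0_eq_expect[OF H_add[OF assms] \<omega>] by auto
qed

lemma expect_scale:
  assumes "Y \<in> H" "0 \<le> c"
  shows "expect (\<lambda>\<omega>. c * Y \<omega>) = c * expect Y"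
proof -
  obtain \<omega> where \<omega>: "\<omega> \<in> space M" using space_nonempty by blast
  have "E 0 (\<lambda>\<omega>. c * Y \<omega>) \<omega> = c * E 0 Y \<omega>"
    using E_homogeneous[of "\<lambda>_. c" 0 Y] H_const assms H_scale[OF assms(1), of c] \<omega>
    by (auto simp: max_def)
  then show ?thesis
    using \<omega> E0_eq_expect[OF assms(1) \<omega>] E0_eq_expect[OF H_scale[OF assms(1)] \<omega>, of c] by simp
qed

lemma expect_zero: "expect (\<lambda>_. 0) = 0"
  using expect_scale[of "\<lambda>_. 0" 0] H_const by simp

lemma expect_nonneg:
  assumes "Y \<in> H" "\<And>\<omega>. \<omega> \<in> space M \<Longrightarrow> 0 \<le> Y \<omega>"
  shows "0 \<le> expect Y"
  using expect_mono[OF assms(1) H_const[of 0]] assms(2) expect_zero by simp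

lemma expect_E:
  assumes "Y \<in> H"
  shows "expect (E t Y) = expect Y"
proof -
  obtain \<omega> where \<omega>: "\<omega> \<in> space M" using space_nonempty by blast
  show ?thesis
    using E_tower[OF assms, of 0 t] \<omega> E0_eq_expect[OF assms \<omega>]
      E0_eq_expect[OF E_in_H[OF assms] \<omega>] by simp
qed

text \<open>Both \<open>E t X - E t Y\<close> and its negative lie below
  \<open>E t \<bar>X - Y\<bar>\<close>, whose expectation the tower property computes. This
  contraction property is what lets \<open>E t\<close> extend to the completion.\<close>

lemma expect_abs_E_diff_le:
  assumes "X \<in> H" "Y \<in> H"
  shows "expect (\<lambda>\<omega>. \<bar>E t X \<omega> - E t Y \<omega>\<bar>) \<le> expect (\<lambda>\<omega>. \<bar>X \<omega> - Y \<omega>\<bar>)"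
proof -
  let ?D = "\<lambda>\<omega>. \<bar>X \<omega> - Y \<omega>\<bar>"
  have D: "?D \<in> H"
    by (intro H_abs H_diff assms)
  have "\<bar>E t X \<omega> - E t Y \<omega>\<bar> \<le> E t ?D \<omega>" if "\<omega> \<in> space M" for \<omega>
  proof -
    have "\<forall>\<omega>\<in>space M. X \<omega> - Y \<omega> \<le> ?D \<omega>" "\<forall>\<omega>\<in>space M. Y \<omega> - X \<omega> \<le> ?D \<omega>"
      by auto
    then have "E t (\<lambda>\<omega>. X \<omega> - Y \<omega>) \<omega> \<le> E t ?D \<omega>" "E t (\<lambda>\<omega>. Y \<omega> - X \<omega>) \<omega> \<le> E t ?D \<omega>"
      using E_mono[OF D H_diff[OF assms], of t] E_mono[OF D H_diff[OF assms(2,1)], of t] that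
      by blast+
    then show ?thesis
      using E_diff_le[OF assms that, of t] E_diff_le[OF assms(2,1) that, of t] by linarith
  qed
  then have "expect (\<lambda>\<omega>. \<bar>E t X \<omega> - E t Y \<omega>\<bar>) \<le> expect (E t ?D)"
    by (intro expect_mono E_in_H D H_abs H_diff assms)
  then show ?thesis
    using expect_E[OF D] by simp
qed

text \<open>The remainders \<open>(W - \<Sum>j<n. G j)\<^sup>+\<close> decrease to 0 pointwise, so continuity from above applies.\<close>

lemma expect_countably_subadditive:
  fixes G :: "nat \<Rightarrow> 'a \<Rightarrow> real"
  assumes W: "W \<in> H" and G: "\<And>j. G j \<in> H"
    and G_nonneg: "\<And>j \<omega>. \<omega> \<in> space M \<Longrightarrow> 0 \<le> G j \<omega>"
    and bound: "\<And>\<omega> e. \<omega> \<in> space M \<Longrightarrow> 0 < e \<Longrightarrow> \<exists>n. W \<omega> \<le> (\<Sum>j<n. G j \<omega>) + e"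
    and c: "\<And>n. (\<Sum>j<n. expect (G j)) \<le> c"
  shows "expect W \<le> c"
proof -
  let ?S = "\<lambda>n \<omega>. \<Sum>j<n. G j \<omega>"
  let ?R = "\<lambda>n \<omega>. max (W \<omega> - ?S n \<omega>) 0"
  have S: "?S n \<in> H" for n
    by (intro H_sum G)
  have R: "?R n \<in> H" for n
    by (intro H_pos_part H_diff W S)
  have "decseq (\<lambda>i. ?R i \<omega>) \<and> (\<lambda>i. ?R i \<omega>) \<longlonglongrightarrow> 0" if \<omega>: "\<omega> \<in> space M" for \<omega>
  proof
    show dec: "decseq (\<lambda>i. ?R i \<omega>)"
    proof (rule decseq_SucI)
      show "?R (Suc n) \<omega> \<le> ?R n \<omega>" for n
        using G_nonneg[OF \<omega>, of n] by simp
    qed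
    show "(\<lambda>i. ?R i \<omega>) \<longlonglongrightarrow> 0"
    proof (rule LIMSEQ_I)
      fix r :: real assume "0 < r"
      then obtain n where n: "W \<omega> \<le> ?S n \<omega> + r / 2"
        using bound[OF \<omega>, of "r / 2"] by auto
      have "norm (?R i \<omega> - 0) < r" if "n \<le> i" for i
        using decseqD[OF dec that] n \<open>0 < r\<close> by (auto simp: max_def split: if_splits)
      then show "\<exists>no. \<forall>i\<ge>no. norm (?R i \<omega> - 0) < r"
        by blast
    qed
  qed
  then have E0_lim: "\<forall>\<omega>\<in>space M. (\<lambda>i. E 0 (?R i) \<omega>) \<longlonglongrightarrow> 0"
    by (intro E_continuous R)
  obtain \<omega> where \<omega>: "\<omega> \<in> space M"
    using space_nonempty by blast
  have lim: "(\<lambda>i. expect (?R i)) \<longlonglongrightarrow> 0"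
    using bspec[OF E0_lim \<omega>] unfolding E0_eq_expect[OF R \<omega>] .
  have sum: "expect (?S n) \<le> (\<Sum>j<n. expect (G j))" for n
  proof (induction n)
    case (Suc n)
    then show ?case
      using expect_add_le[OF S[of n] G[of n]] by simp
  qed (simp add: expect_zero)
  \<comment> \<open>\<open>W\<close> lies below the partial sum plus the remainder, so finite
    subadditivity is enough before passing to the limit.\<close>
  have "expect W \<le> c + expect (?R n)" for n
  proof -
    have "expect W \<le> expect (\<lambda>\<omega>. ?S n \<omega> + ?R n \<omega>)"
      by (intro expect_mono W H_add S R) auto
    then show ?thesis
      using expect_add_le[OF S R, of n n] sum[of n] c[of n] by linarith
  qed
  then show ?thesis
    using LIMSEQ_le_const[OF tendsto_add[OF tendsto_const lim, of c], of "expect W"] by auto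
qed

section \<open>Null sets and quasi-sure statements\<close>

text \<open>\<open>Y\<close> may be unbounded, but at each point of \<open>A\<close> it lies below
  some natural number. So the product is dominated by a series of copies of
  \<open>indicator A\<close>, each of expectation 0.\<close>

lemma expect_indicator_null:
  assumes "A \<in> sets M" "expect (indicator A) = 0" "Y \<in> H"
  shows "expect (\<lambda>\<omega>. indicator A \<omega> * Y \<omega>) \<le> 0"
proof (rule expect_countably_subadditive[where G = "\<lambda>_. indicator A"])
  show "\<exists>n. indicator A \<omega> * Y \<omega> \<le> (\<Sum>j<(n::nat). indicator A \<omega>) + e" if "0 < e" for \<omega> e
  proof -
    obtain n :: nat where "Y \<omega> \<le> real n"
      using real_arch_simple by blast
    then have "indicator A \<omega> * Y \<omega> \<le> (\<Sum>j<n. indicator A \<omega>) + e"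
      using that by (cases "\<omega> \<in> A") simp_all
    then show ?thesis
      by blast
  qed
qed (use assms in \<open>simp_all add: H_indicator H_indicator_const\<close>)

lemma null_set_Un:
  assumes "A \<in> sets M" "B \<in> sets M" "expect (indicator A) = 0" "expect (indicator B) = 0"
  shows "expect (indicator (A \<union> B)) = 0"
proof -
  note * = H_indicator_const
  have "expect (indicator (A \<union> B)) \<le> expect (\<lambda>\<omega>. indicator A \<omega> + indicator B \<omega>)"
    using assms by (intro expect_mono H_add *) (auto simp: indicator_def)
  also have "\<dots> \<le> 0"
    using expect_add_le[OF *[OF assms(1)] *[OF assms(2)]] assms by simp
  finally show ?thesis
    using expect_nonneg[OF *[of "A \<union> B"]] assms by fastforce
qed

lemma quasi_surelyI: "(\<And>\<omega>. \<omega> \<in> space M \<Longrightarrow> P \<omega>) \<Longrightarrow> quasi_surely P"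
  unfolding quasi_surely_def
  by (intro bexI[of _ "{}"]) (auto simp: expect_zero indicator_def[abs_def])

lemma quasi_surely_mono:
  assumes "quasi_surely P" "\<And>\<omega>. \<omega> \<in> space M \<Longrightarrow> P \<omega> \<Longrightarrow> Q \<omega>"
  shows "quasi_surely Q"
  using assms unfolding quasi_surely_def by blast

lemma quasi_surely_conj:
  assumes "quasi_surely P" "quasi_surely Q"
  shows "quasi_surely (\<lambda>\<omega>. P \<omega> \<and> Q \<omega>)"
proof -
  obtain A B where A: "A \<in> sets M" "expect (indicator A) = 0" "\<forall>\<omega>\<in>space M - A. P \<omega>"
    and B: "B \<in> sets M" "expect (indicator B) = 0" "\<forall>\<omega>\<in>space M - B. Q \<omega>"
    using assms unfolding quasi_surely_def by blast
  then show ?thesis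
    unfolding quasi_surely_def by (intro bexI[of _ "A \<union> B"]) (auto intro: null_set_Un)
qed

lemma quasi_surely_all_le:
  fixes P :: "nat \<Rightarrow> 'a \<Rightarrow> bool"
  assumes "\<And>s. s \<le> n \<Longrightarrow> quasi_surely (P s)"
  shows "quasi_surely (\<lambda>\<omega>. \<forall>s\<le>n. P s \<omega>)"
  using assms
proof (induction n)
  case (Suc n)
  then have "quasi_surely (\<lambda>\<omega>. (\<forall>s\<le>n. P s \<omega>) \<and> P (Suc n) \<omega>)"
    by (intro quasi_surely_conj) auto
  then show ?case
    by (rule quasi_surely_mono) (auto simp: le_Suc_eq)
qed auto

section \<open>The norm of measurable functions\<close>

lemma expect_le_norm1:
  assumes "Y \<in> H" "\<And>\<omega>. \<omega> \<in> space M \<Longrightarrow> ereal (Y \<omega>) \<le> \<bar>Z \<omega>\<bar>"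
  shows "ereal (expect Y) \<le> norm1 Z"
  unfolding norm1_def using assms by (intro SUP_upper) auto

lemma norm1_nonneg: "0 \<le> norm1 Z"
  using expect_le_norm1[OF H_const[of 0], of Z] expect_zero by (simp flip: zero_ereal_def)

lemma norm1_le_expect:
  assumes "Y \<in> H"
  shows "norm1 (\<lambda>\<omega>. ereal (Y \<omega>)) \<le> ereal (expect (\<lambda>\<omega>. \<bar>Y \<omega>\<bar>))"
  unfolding norm1_def using assms by (intro SUP_least) (auto intro: expect_mono H_abs)

lemma norm1_zero: "norm1 (\<lambda>_. 0) = 0"
  using norm1_le_expect[OF H_const[of 0]] norm1_nonneg[of "\<lambda>_. 0"]
  by (simp add: expect_zero zero_ereal_def[symmetric])

lemma norm1_cong:
  assumes "\<And>\<omega>. \<omega> \<in> space M \<Longrightarrow> Z \<omega> = Z' \<omega>"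
  shows "norm1 Z = norm1 Z'"
  unfolding norm1_def using assms by (intro arg_cong[where f = Sup] image_cong) auto

text \<open>\<open>Y / 3\<close> is a competitor in the supremum that defines
  \<open>norm1 Z\<close>.\<close>

lemma expect_le_3_norm1:
  assumes "Y \<in> H" "\<And>\<omega>. \<omega> \<in> space M \<Longrightarrow> ereal (Y \<omega>) \<le> 3 * \<bar>Z \<omega>\<bar>"
  shows "ereal (expect Y) \<le> 3 * norm1 Z"
proof -
  have "ereal (expect (\<lambda>\<omega>. (1/3) * Y \<omega>)) \<le> norm1 Z"
  proof (intro expect_le_norm1 H_scale assms(1))
    fix \<omega> assume "\<omega> \<in> space M"
    then show "ereal (1 / 3 * Y \<omega>) \<le> \<bar>Z \<omega>\<bar>"
      using assms(2)[of \<omega>] by (cases "Z \<omega>") auto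
  qed
  then show ?thesis
    using expect_scale[OF assms(1), of "1/3"] by (cases "norm1 Z") auto
qed

text \<open>The constant 3 is not optimal, but it lets us split a function below the sum by the indicators
  of the sets where one of the three summands is the largest; \<open>H\<close> is closed under indicators,
  not under the minimum with an arbitrary measurable function.\<close>

lemma norm1_triangle:
  assumes [measurable]: "A \<in> borel_measurable M" "B \<in> borel_measurable M" "C \<in> borel_measurable M"
    and "quasi_surely (\<lambda>\<omega>. \<bar>Z \<omega>\<bar> \<le> \<bar>A \<omega>\<bar> + \<bar>B \<omega>\<bar> + \<bar>C \<omega>\<bar>)"
  shows "norm1 Z \<le> 3 * norm1 A + 3 * norm1 B + 3 * norm1 C"
proof -
  obtain N where N[measurable]: "N \<in> sets M" and "expect (indicator N) = 0"
    and le: "\<And>\<omega>. \<omega> \<in> space M - N \<Longrightarrow> \<bar>Z \<omega>\<bar> \<le> \<bar>A \<omega>\<bar> + \<bar>B \<omega>\<bar> + \<bar>C \<omega>\<bar>"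
    using assms(4) unfolding quasi_surely_def by blast
  \<comment> \<open>Ties go to the earlier summand, so \<open>P\<close>, \<open>Q\<close>,
    \<open>R\<close> and \<open>N\<close> are disjoint and cover the space. Outside \<open>P\<close>
    one of \<open>B\<close>, \<open>C\<close> exceeds \<open>A\<close> in absolute value, so
    \<open>B\<close> dominates on \<open>Q\<close> and \<open>C\<close> on \<open>R\<close>.\<close>
  define P where "P = {\<omega> \<in> space M. \<omega> \<notin> N \<and> \<bar>B \<omega>\<bar> \<le> \<bar>A \<omega>\<bar> \<and> \<bar>C \<omega>\<bar> \<le> \<bar>A \<omega>\<bar>}"
  define Q where "Q = {\<omega> \<in> space M. \<omega> \<notin> N \<and> \<omega> \<notin> P \<and> \<bar>C \<omega>\<bar> \<le> \<bar>B \<omega>\<bar>}"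
  define R where "R = {\<omega> \<in> space M. \<omega> \<notin> N \<and> \<omega> \<notin> P \<and> \<omega> \<notin> Q}"
  have P: "P \<in> sets M"
    unfolding P_def by measurable
  then have Q: "Q \<in> sets M"
    unfolding Q_def by measurable
  then have R: "R \<in> sets M"
    using P unfolding R_def by measurable
  have dom: "x \<le> 3 * a" if "x \<le> a + b + c" "b \<le> a" "c \<le> a" for x a b c :: ereal
  proof -
    have "a + b + c \<le> a + a + a"
      using that by (intro add_mono) auto
    moreover have "a + a + a = 3 * a"
      by (cases a) auto
    ultimately show ?thesis
      using that(1) by (metis order_trans)
  qed
  show ?thesis
    unfolding norm1_def[of Z]
  proof (rule SUP_least, clarify)
    fix W assume W: "W \<in> H" and WZ: "\<forall>\<omega>\<in>space M. ereal (W \<omega>) \<le> \<bar>Z \<omega>\<bar>"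
    let ?I = "\<lambda>D \<omega>. indicator D \<omega> * W \<omega>"
    have I: "?I D \<in> H" if "D \<in> sets M" for D
      using that W by (rule H_indicator[rotated])
    have W_le: "ereal (W \<omega>) \<le> \<bar>A \<omega>\<bar> + \<bar>B \<omega>\<bar> + \<bar>C \<omega>\<bar>" if "\<omega> \<in> space M - N" for \<omega>
      using WZ le[OF that] that by (auto intro: order_trans)
    have "expect W \<le> expect (\<lambda>\<omega>. ((?I P \<omega> + ?I Q \<omega>) + ?I R \<omega>) + ?I N \<omega>)"
      using P Q R N W by (intro expect_mono H_add I) (auto simp: P_def Q_def R_def indicator_def)
    also have "\<dots> \<le> expect (?I P) + expect (?I Q) + expect (?I R) + expect (?I N)"
      using expect_add_le[OF H_add[OF H_add[OF I[OF P] I[OF Q]] I[OF R]] I[OF N]]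
        expect_add_le[OF H_add[OF I[OF P] I[OF Q]] I[OF R]] expect_add_le[OF I[OF P] I[OF Q]]
      by linarith
    \<comment> \<open>The exceptional set contributes nothing positive, even though \<open>W\<close>
      may be unbounded on it.\<close>
    also have "\<dots> \<le> expect (?I P) + expect (?I Q) + expect (?I R)"
      using expect_indicator_null[OF N \<open>expect (indicator N) = 0\<close> W] by simp
    finally have "ereal (expect W) \<le> ereal (expect (?I P)) + ereal (expect (?I Q)) + ereal (expect (?I R))"
      by simp
    also have "\<dots> \<le> 3 * norm1 A + 3 * norm1 B + 3 * norm1 C"
    proof (intro add_mono)
      show "ereal (expect (?I P)) \<le> 3 * norm1 A"
      proof (intro expect_le_3_norm1 I P)
        fix \<omega> assume "\<omega> \<in> space M"
        then show "ereal (?I P \<omega>) \<le> 3 * \<bar>A \<omega>\<bar>"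
          using dom[OF W_le, of \<omega>] by (cases "\<omega> \<in> P") (auto simp: P_def simp flip: zero_ereal_def)
      qed
      show "ereal (expect (?I Q)) \<le> 3 * norm1 B"
      proof (intro expect_le_3_norm1 I Q)
        fix \<omega> assume "\<omega> \<in> space M"
        show "ereal (?I Q \<omega>) \<le> 3 * \<bar>B \<omega>\<bar>"
        proof (cases "\<omega> \<in> Q")
          case True
          then have "\<omega> \<in> space M - N" "\<bar>A \<omega>\<bar> \<le> \<bar>B \<omega>\<bar>" "\<bar>C \<omega>\<bar> \<le> \<bar>B \<omega>\<bar>"
            by (auto simp: P_def Q_def)
          then show ?thesis
            using dom[of "ereal (W \<omega>)" "\<bar>B \<omega>\<bar>" "\<bar>A \<omega>\<bar>" "\<bar>C \<omega>\<bar>"] W_le[of \<omega>] True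
            by (simp add: add_ac)
        qed (simp flip: zero_ereal_def)
      qed
      show "ereal (expect (?I R)) \<le> 3 * norm1 C"
      proof (intro expect_le_3_norm1 I R)
        fix \<omega> assume "\<omega> \<in> space M"
        show "ereal (?I R \<omega>) \<le> 3 * \<bar>C \<omega>\<bar>"
        proof (cases "\<omega> \<in> R")
          case True
          then have "\<omega> \<in> space M - N" "\<bar>A \<omega>\<bar> \<le> \<bar>C \<omega>\<bar>" "\<bar>B \<omega>\<bar> \<le> \<bar>C \<omega>\<bar>"
            by (auto simp: P_def Q_def R_def)
          then show ?thesis
            using dom[of "ereal (W \<omega>)" "\<bar>C \<omega>\<bar>" "\<bar>A \<omega>\<bar>" "\<bar>B \<omega>\<bar>"] W_le[of \<omega>] True
            by (simp add: add_ac)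
        qed (simp flip: zero_ereal_def)
      qed
    qed
    finally show "ereal (expect W) \<le> 3 * norm1 A + 3 * norm1 B + 3 * norm1 C" .
  qed
qed

lemma norm1_triangle2:
  assumes "A \<in> borel_measurable M" "B \<in> borel_measurable M"
    and "quasi_surely (\<lambda>\<omega>. \<bar>Z \<omega>\<bar> \<le> \<bar>A \<omega>\<bar> + \<bar>B \<omega>\<bar>)"
  shows "norm1 Z \<le> 3 * norm1 A + 3 * norm1 B"
  using norm1_triangle[OF assms(1,2), of "\<lambda>_. 0" Z] assms(3) by (simp add: norm1_zero)

text \<open>Markov's inequality makes each set where \<open>\<bar>Z\<bar>\<close> is at least
  \<open>1 / Suc k\<close> null. These sets cover the set where \<open>Z\<close> is nonzero, and
  countable subadditivity makes that set null too.\<close>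

lemma norm1_eq_zero_imp:
  assumes [measurable]: "Z \<in> borel_measurable M" and "norm1 Z = 0"
  shows "quasi_surely (\<lambda>\<omega>. Z \<omega> = 0)"
proof -
  define A where "A = (\<lambda>k::nat. {\<omega> \<in> space M. ereal (1 / Suc k) \<le> \<bar>Z \<omega>\<bar>})"
  have A: "A k \<in> sets M" for k
    unfolding A_def by measurable
  have A_null: "expect (indicator (A k)) \<le> 0" for k
  proof -
    have "ereal (expect (\<lambda>\<omega>. (1 / Suc k) * indicator (A k) \<omega>)) \<le> norm1 Z"
      by (intro expect_le_norm1 H_scale H_indicator_const A)
         (auto simp: A_def indicator_def simp flip: zero_ereal_def)
    then have "(1 / Suc k) * expect (indicator (A k)) \<le> 0"
      using expect_scale[OF H_indicator_const[OF A[of k]], of "1 / Suc k"] assms(2) by simp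
    then show ?thesis
      by (simp add: field_simps)
  qed
  define N where "N = {\<omega> \<in> space M. Z \<omega> \<noteq> 0}"
  have N: "N \<in> sets M"
    unfolding N_def by measurable
  have "expect (indicator N) \<le> 0"
  proof (rule expect_countably_subadditive[where G = "\<lambda>k. indicator (A k)"])
    fix \<omega> and e :: real assume \<omega>: "\<omega> \<in> space M" and e: "0 < e"
    show "\<exists>n. indicator N \<omega> \<le> (\<Sum>j<n. indicator (A j) \<omega>) + e"
    proof (cases "\<omega> \<in> N")
      case True
      have "\<exists>k. ereal (1 / Suc k) \<le> \<bar>Z \<omega>\<bar>"
      proof (cases "Z \<omega>")
        case (real r)
        then have "0 < \<bar>r\<bar>" using True by (auto simp: N_def)
        then obtain k where "1 / real (Suc k) < \<bar>r\<bar>"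
          using nat_approx_posE by blast
        then show ?thesis using real by (auto intro!: exI[of _ k])
      qed auto
      then obtain k where "\<omega> \<in> A k"
        using \<omega> by (auto simp: A_def)
      \<comment> \<open>The sum must run to \<open>Suc k\<close> in order to include the summand
        with index \<open>k\<close>.\<close>
      then have "1 \<le> (\<Sum>j<Suc k. indicator (A j) \<omega> :: real)"
        by (simp add: sum_nonneg)
      then show ?thesis
        using True e by (intro exI[of _ "Suc k"]) auto
    qed (use e in \<open>auto intro: exI[of _ 0]\<close>)
  qed (use A N A_null in \<open>auto intro: H_indicator_const sum_nonpos\<close>)
  then have "expect (indicator N) = 0"
    using expect_nonneg[OF H_indicator_const[OF N]] by fastforce
  then show ?thesis
    unfolding quasi_surely_def using N by (intro bexI[of _ N]) (auto simp: N_def)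
qed

section \<open>Convergence to elements of \<open>L1\<close> and completeness\<close>

lemma L1_limD:
  assumes "L1_lim Xs X"
  shows "Xs n \<in> H" "X \<in> borel_measurable M"
    "(\<lambda>n. norm1 (\<lambda>\<omega>. X \<omega> - ereal (Xs n \<omega>))) \<longlonglongrightarrow> 0"
    "(\<lambda>\<omega>. X \<omega> - ereal (Xs n \<omega>)) \<in> borel_measurable M"
proof -
  show *: "Xs n \<in> H" "X \<in> borel_measurable M"
    "(\<lambda>n. norm1 (\<lambda>\<omega>. X \<omega> - ereal (Xs n \<omega>))) \<longlonglongrightarrow> 0"
    using assms by (auto simp: L1_lim_def)
  have [measurable]: "Xs n \<in> borel_measurable M" "X \<in> borel_measurable M"
    using * H_measurable by auto
  show "(\<lambda>\<omega>. X \<omega> - ereal (Xs n \<omega>)) \<in> borel_measurable M"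
    by measurable
qed

lemma L1_limI:
  assumes "\<And>n. Xs n \<in> H" "X \<in> borel_measurable M"
    and "\<And>n. norm1 (\<lambda>\<omega>. X \<omega> - ereal (Xs n \<omega>)) \<le> b n" "b \<longlonglongrightarrow> 0"
  shows "L1_lim Xs X"
proof -
  have "(\<lambda>n. norm1 (\<lambda>\<omega>. X \<omega> - ereal (Xs n \<omega>))) \<longlonglongrightarrow> 0"
    by (rule tendsto_sandwich[OF _ _ tendsto_const assms(4)])
       (simp_all add: norm1_nonneg assms(3))
  with assms(1,2) show ?thesis
    by (simp add: L1_lim_def)
qed

text \<open>Measurability and \<open>norm1\<close> see only values on the sample space. Membership
  in \<open>H\<close> is a separate hypothesis because \<open>H\<close> is not assumed closed under
  changes off \<open>space M\<close>.\<close>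

lemma L1_lim_cong:
  assumes "L1_lim Xs X" "\<And>n. Ys n \<in> H"
    and "\<And>n \<omega>. \<omega> \<in> space M \<Longrightarrow> Xs n \<omega> = Ys n \<omega>" "\<And>\<omega>. \<omega> \<in> space M \<Longrightarrow> X \<omega> = Y \<omega>"
  shows "L1_lim Ys Y"
proof (rule L1_limI)
  show "Y \<in> borel_measurable M"
    using L1_limD(2)[OF assms(1)] measurable_cong[of M X Y] assms(4) by blast
  show "norm1 (\<lambda>\<omega>. Y \<omega> - ereal (Ys n \<omega>)) \<le> norm1 (\<lambda>\<omega>. X \<omega> - ereal (Xs n \<omega>))" for n
    by (intro eq_refl norm1_cong) (simp add: assms)
qed (rule assms(2) L1_limD(3)[OF assms(1)])+

text \<open>With the upper limit, \<open>\<bar>Y - Ys k\<bar>\<close> is bounded by the series of the later increments everywhere, also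
  where the sequence diverges, so no exceptional set has to be removed.\<close>

lemma L1_lim_fast:
  assumes Y: "\<And>n. Ys n \<in> H"
    and c: "\<And>n. expect (\<lambda>\<omega>. \<bar>Ys (Suc n) \<omega> - Ys n \<omega>\<bar>) \<le> c * (1/2) ^ n"
  shows "L1_lim Ys (\<lambda>\<omega>. limsup (\<lambda>n. ereal (Ys n \<omega>)))"
proof (rule L1_limI)
  let ?Y = "\<lambda>\<omega>. limsup (\<lambda>n. ereal (Ys n \<omega>))"
  have [measurable]: "Ys n \<in> borel_measurable M" for n
    using Y H_measurable by auto
  show "?Y \<in> borel_measurable M"
    by measurable
  \<comment> \<open>The bound is the geometric tail: the increments from index \<open>k\<close> on
    have total expectation at most \<open>c * (1/2) ^ k * 2\<close>.\<close>
  show "norm1 (\<lambda>\<omega>. ?Y \<omega> - ereal (Ys k \<omega>)) \<le> ereal (2 * c * (1/2) ^ k)" for k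
    unfolding norm1_def
  proof (rule SUP_least, clarify)
    fix W assume W: "W \<in> H" and WY: "\<forall>\<omega>\<in>space M. ereal (W \<omega>) \<le> \<bar>?Y \<omega> - ereal (Ys k \<omega>)\<bar>"
    let ?G = "\<lambda>j \<omega>. \<bar>Ys (Suc (k + j)) \<omega> - Ys (k + j) \<omega>\<bar>"
    have "expect W \<le> 2 * c * (1/2) ^ k"
    proof (rule expect_countably_subadditive[where G = ?G])
      fix \<omega> and e :: real assume \<omega>: "\<omega> \<in> space M" and e: "0 < e"
      show "\<exists>n. W \<omega> \<le> (\<Sum>j<n. ?G j \<omega>) + e"
      proof (rule ccontr)
        \<comment> \<open>If every partial sum stayed below \<open>W \<omega> - e\<close>, all later
          terms, and with them the upper limit, would lie within that distance of
          \<open>Ys k \<omega>\<close>. This contradicts the choice of \<open>W\<close>.\<close>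
        assume "\<nexists>n. W \<omega> \<le> (\<Sum>j<n. ?G j \<omega>) + e"
        then have less: "(\<Sum>j<n. ?G j \<omega>) \<le> W \<omega> - e" for n
          by (auto simp: not_le intro: less_imp_le dest: spec[of _ n])
        have tel: "\<bar>Ys (k + n) \<omega> - Ys k \<omega>\<bar> \<le> (\<Sum>j<n. ?G j \<omega>)" for n
          by (induction n) auto
        have near: "Ys k \<omega> - (W \<omega> - e) \<le> Ys m \<omega>" "Ys m \<omega> \<le> Ys k \<omega> + (W \<omega> - e)" if "k \<le> m" for m
          using tel[of "m - k"] less[of "m - k"] that by (auto simp: abs_le_iff)
        have "?Y \<omega> \<le> ereal (Ys k \<omega> + (W \<omega> - e))"
          by (rule Limsup_bounded) (use near in \<open>auto simp: eventually_sequentially\<close>)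
        moreover have "ereal (Ys k \<omega> - (W \<omega> - e)) \<le> liminf (\<lambda>n. ereal (Ys n \<omega>))"
          by (rule Liminf_bounded) (use near in \<open>auto simp: eventually_sequentially\<close>)
        then have "ereal (Ys k \<omega> - (W \<omega> - e)) \<le> ?Y \<omega>"
          using Liminf_le_Limsup[of sequentially "\<lambda>n. ereal (Ys n \<omega>)"] by (auto intro: order_trans)
        ultimately have "\<bar>?Y \<omega> - ereal (Ys k \<omega>)\<bar> \<le> ereal (W \<omega> - e)"
          by (cases "?Y \<omega>") auto
        with bspec[OF WY \<omega>] have "ereal (W \<omega>) \<le> ereal (W \<omega> - e)"
          by (rule order_trans)
        then show False
          using e by simp
      qed
    next
      fix n
      have c0: "0 \<le> c"
        using c[of 0] expect_nonneg[OF H_abs[OF H_diff[OF Y[of "Suc 0"] Y[of 0]]]] by simp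
      have "(\<Sum>j<n. expect (?G j)) \<le> (\<Sum>j<n. c * (1/2) ^ (k + j))"
        by (intro sum_mono c)
      also have "\<dots> = c * (1/2) ^ k * (\<Sum>j<n. (1/2) ^ j)"
        by (simp add: sum_distrib_left power_add mult.assoc)
      also have "(\<Sum>j<n. (1/2) ^ j) = 2 - 2 * (1/2 :: real) ^ n"
        by (induction n) auto
      also have "c * (1/2) ^ k * (2 - 2 * (1/2 :: real) ^ n) \<le> c * (1/2) ^ k * 2"
        using c0 by (intro mult_left_mono) auto
      finally show "(\<Sum>j<n. expect (?G j)) \<le> 2 * c * (1/2) ^ k"
        by simp
    qed (simp_all add: W H_abs[OF H_diff[OF Y Y]])
    then show "ereal (expect W) \<le> ereal (2 * c * (1/2) ^ k)"
      by simp
  qed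
  have "(\<lambda>k. 2 * c * (1/2) ^ k) \<longlonglongrightarrow> 0"
    by (intro tendsto_mult_right_zero LIMSEQ_power_zero) simp
  then show "(\<lambda>k. ereal (2 * c * (1/2) ^ k)) \<longlonglongrightarrow> 0"
    unfolding zero_ereal_def by (rule tendsto_ereal)
qed (rule Y)

text \<open>Choosing for each \<open>n\<close> an approximant at distance at most
  \<open>(1/2) ^ n\<close> gives summable increments, the form that the completeness argument takes
  as input. The chosen indices need not increase.\<close>

lemma L1_fast_sequence:
  assumes "X \<in> L1"
  obtains Xs where "L1_lim Xs X"
    "\<And>n. expect (\<lambda>\<omega>. \<bar>Xs (Suc n) \<omega> - Xs n \<omega>\<bar>) \<le> 6 * (1/2) ^ n"
proof -
  obtain Ys where Ys: "L1_lim Ys X"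
    using assms by (auto simp: L1_def)
  have "\<exists>m. norm1 (\<lambda>\<omega>. X \<omega> - ereal (Ys m \<omega>)) \<le> ereal ((1/2) ^ n)" for n
  proof -
    have "\<forall>\<^sub>F m in sequentially. norm1 (\<lambda>\<omega>. X \<omega> - ereal (Ys m \<omega>)) < ereal ((1/2) ^ n)"
      by (rule order_tendstoD(2)[OF L1_limD(3)[OF Ys]]) simp
    then show ?thesis
      by (auto simp: eventually_sequentially intro: less_imp_le)
  qed
  then obtain r where r: "\<And>n. norm1 (\<lambda>\<omega>. X \<omega> - ereal (Ys (r n) \<omega>)) \<le> ereal ((1/2) ^ n)"
    by metis
  let ?Xs = "\<lambda>n. Ys (r n)"
  have "L1_lim ?Xs X"
  proof (rule L1_limI[OF L1_limD(1,2)[OF Ys] r])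
    have "(\<lambda>n. (1/2 :: real) ^ n) \<longlonglongrightarrow> 0"
      by (intro LIMSEQ_power_zero) simp
    then show "(\<lambda>n. ereal ((1/2) ^ n)) \<longlonglongrightarrow> 0"
      unfolding zero_ereal_def by (rule tendsto_ereal)
  qed
  moreover have "expect (\<lambda>\<omega>. \<bar>?Xs (Suc n) \<omega> - ?Xs n \<omega>\<bar>) \<le> 6 * (1/2) ^ n" for n
  proof -
    let ?D = "\<lambda>\<omega>. \<bar>?Xs (Suc n) \<omega> - ?Xs n \<omega>\<bar>"
    have le: "ereal \<bar>u - v\<bar> \<le> \<bar>x - ereal u\<bar> + \<bar>x - ereal v\<bar>" for u v x
      by (cases x) auto
    have "ereal (expect ?D) \<le> norm1 (\<lambda>\<omega>. ereal (?D \<omega>))"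
      by (intro expect_le_norm1 H_abs H_diff L1_limD(1)[OF Ys]) auto
    also have "\<dots> \<le> 3 * norm1 (\<lambda>\<omega>. X \<omega> - ereal (?Xs (Suc n) \<omega>)) + 3 * norm1 (\<lambda>\<omega>. X \<omega> - ereal (?Xs n \<omega>))"
      by (intro norm1_triangle2 L1_limD(4)[OF Ys] quasi_surelyI) (simp add: le)
    also have "\<dots> \<le> 3 * ereal ((1/2) ^ Suc n) + 3 * ereal ((1/2) ^ n)"
      by (intro add_mono ereal_mult_left_mono r) auto
    \<comment> \<open>The sum equals \<open>4.5 * (1/2) ^ n\<close>; the constant 6 is a generous
      rounding.\<close>
    also have "\<dots> \<le> ereal (6 * (1/2) ^ n)"
      by simp
    finally show ?thesis
      by simp
  qed
  ultimately show ?thesis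
    using that by blast
qed

section \<open>Versions of the extended conditional expectations\<close>

text \<open>\<open>ce t X Y\<close>: the function \<open>Y\<close> is a version of the extension of \<^term>\<open>E t\<close> at \<open>X\<close>.\<close>

definition ce :: "nat \<Rightarrow> ('a \<Rightarrow> ereal) \<Rightarrow> ('a \<Rightarrow> ereal) \<Rightarrow> bool" where
  "ce t X Y \<longleftrightarrow> (\<exists>Xs. L1_lim Xs X \<and> L1_lim (\<lambda>n. E t (Xs n)) Y)"

text \<open>One fast approximating sequence serves all times: by contraction its images under each
  \<open>E u\<close> are again fast and converge. On \<open>H\<close> the tower property identifies
  \<open>E s (E t (Xs n))\<close> with \<open>E s (Xs n)\<close>, so both sequences share the limit
  \<open>Z\<close>.\<close>

lemma ce_tower:
  assumes "X \<in> L1" "s \<le> t"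
  obtains Y Z where "ce t X Y" "ce s X Z" "ce s Y Z"
proof -
  obtain Xs where Xs: "L1_lim Xs X"
    and fast: "\<And>n. expect (\<lambda>\<omega>. \<bar>Xs (Suc n) \<omega> - Xs n \<omega>\<bar>) \<le> 6 * (1/2) ^ n"
    using L1_fast_sequence[OF assms(1)] by blast
  note H = L1_limD(1)[OF Xs]
  have "\<exists>Y. L1_lim (\<lambda>n. E u (Xs n)) Y" for u
    using L1_lim_fast[of "\<lambda>n. E u (Xs n)" 6] E_in_H[OF H]
      order_trans[OF expect_abs_E_diff_le[OF H H] fast] by blast
  then obtain Y Z where Y: "L1_lim (\<lambda>n. E t (Xs n)) Y" and Z: "L1_lim (\<lambda>n. E s (Xs n)) Z"
    by metis
  have "L1_lim (\<lambda>n. E s (E t (Xs n))) Z"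
    by (rule L1_lim_cong[OF Z]) (use E_tower[OF H assms(2)] E_in_H H in auto)
  then show ?thesis
    using that Xs Y Z unfolding ce_def by blast
qed

text \<open>The tower lemma with equal times supplies a version, so the choice in
  \<open>cond_expect\<close> is legitimate.\<close>

lemma ce_cond_expect:
  assumes "X \<in> L1"
  shows "ce t X (cond_expect t X)"
proof -
  have "\<exists>Y. ce t X Y"
    using ce_tower[OF assms order_refl] by blast
  from someI_ex[OF this] show ?thesis
    unfolding ce_def cond_expect_def .
qed

text \<open>On \<open>A\<close> the positive part of \<open>Us n - Vs n\<close> tends to 0 in norm,
  and its conditional expectation bounds \<open>E t (Us n) - E t (Vs n)\<close> there. So the excess
  of \<open>U'\<close> over \<open>V'\<close> on \<open>A\<close> has norm 0. Taking
  \<open>U = V\<close> compares two versions.\<close>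

lemma ce_local_mono:
  assumes "ce t U U'" "ce t V V'" and A: "A \<in> sets (F t)"
    and le: "quasi_surely (\<lambda>\<omega>. \<omega> \<in> A \<longrightarrow> U \<omega> \<le> V \<omega>)"
  shows "quasi_surely (\<lambda>\<omega>. \<omega> \<in> A \<longrightarrow> U' \<omega> \<le> V' \<omega>)"
proof -
  obtain Us Vs where Us: "L1_lim Us U" and Us': "L1_lim (\<lambda>n. E t (Us n)) U'"
    and Vs: "L1_lim Vs V" and Vs': "L1_lim (\<lambda>n. E t (Vs n)) V'"
    using assms unfolding ce_def by blast
  have AM[measurable]: "A \<in> sets M"
    using A sets_F_subset by blast
  have [measurable]: "U' \<in> borel_measurable M" "V' \<in> borel_measurable M"
    using L1_limD(2) Us' Vs' by auto
  let ?P = "\<lambda>n \<omega>. max (Us n \<omega> - Vs n \<omega>) 0"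
  define R where "R = (\<lambda>n \<omega>. indicator A \<omega> * ?P n \<omega>)"
  have P: "?P n \<in> H" for n
    by (intro H_pos_part H_diff L1_limD(1)[OF Us] L1_limD(1)[OF Vs])
  have R: "R n \<in> H" for n
    unfolding R_def by (intro H_indicator P AM)
  have R_nonneg: "0 \<le> R n \<omega>" for n \<omega>
    by (simp add: R_def)
  let ?u = "\<lambda>n. norm1 (\<lambda>\<omega>. U \<omega> - ereal (Us n \<omega>))"
  let ?v = "\<lambda>n. norm1 (\<lambda>\<omega>. V \<omega> - ereal (Vs n \<omega>))"
  let ?u' = "\<lambda>n. norm1 (\<lambda>\<omega>. U' \<omega> - ereal (E t (Us n) \<omega>))"
  let ?v' = "\<lambda>n. norm1 (\<lambda>\<omega>. V' \<omega> - ereal (E t (Vs n) \<omega>))"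
  have norm_ER: "norm1 (\<lambda>\<omega>. ereal (E t (R n) \<omega>)) \<le> 3 * ?u n + 3 * ?v n" for n
  proof -
    have "norm1 (\<lambda>\<omega>. ereal (E t (R n) \<omega>)) \<le> ereal (expect (\<lambda>\<omega>. \<bar>E t (R n) \<omega>\<bar>))"
      by (intro norm1_le_expect E_in_H R)
    also have "expect (\<lambda>\<omega>. \<bar>E t (R n) \<omega>\<bar>) \<le> expect (E t (R n))"
      by (intro expect_mono H_abs E_in_H R) (simp add: E_nonneg[OF R R_nonneg])
    also have "\<dots> = expect (R n)"
      by (rule expect_E[OF R])
    also have "ereal (expect (R n)) \<le> norm1 (\<lambda>\<omega>. ereal (R n \<omega>))"
      by (intro expect_le_norm1 R) auto
    also have "\<dots> \<le> 3 * ?u n + 3 * ?v n"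
    proof (intro norm1_triangle2 L1_limD(4)[OF Us] L1_limD(4)[OF Vs] quasi_surely_mono[OF le])
      fix \<omega> assume "\<omega> \<in> A \<longrightarrow> U \<omega> \<le> V \<omega>"
      moreover have "R n \<omega> = (if \<omega> \<in> A then ?P n \<omega> else 0)" "\<bar>ereal (R n \<omega>)\<bar> = ereal (R n \<omega>)"
        using R_nonneg by (auto simp: R_def)
      ultimately show "\<bar>ereal (R n \<omega>)\<bar> \<le> \<bar>U \<omega> - ereal (Us n \<omega>)\<bar> + \<bar>V \<omega> - ereal (Vs n \<omega>)\<bar>"
        using ereal_pos_part_diff_bound[of "U \<omega>" "V \<omega>" "Us n \<omega>" "Vs n \<omega>"]
        by (simp flip: zero_ereal_def)
    qed
    finally show ?thesis
      by simp
  qed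
  have E_le: "E t (Us n) \<omega> - E t (Vs n) \<omega> \<le> E t (R n) \<omega>" if "\<omega> \<in> A" for n \<omega>
  proof -
    have \<omega>: "\<omega> \<in> space M"
      using that AM sets.sets_into_space by blast
    note H = L1_limD(1)[OF Us, of n] L1_limD(1)[OF Vs, of n]
    have "E t (\<lambda>\<omega>. Us n \<omega> - Vs n \<omega>) \<omega> \<le> E t (?P n) \<omega>"
      using E_mono[OF P[of n] H_diff[OF H], of t] \<omega> by simp
    \<comment> \<open>Since \<open>A\<close> belongs to \<open>F t\<close>, its indicator passes
      through \<open>E t\<close>.\<close>
    moreover have "E t (R n) \<omega> = E t (?P n) \<omega>"
      using E_local[OF P[of n] A] \<omega> that by (simp add: R_def)
    ultimately show ?thesis
      using E_diff_le[OF H \<omega>, of t] by linarith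
  qed
  \<comment> \<open>The strict inequality keeps equal infinite values out of the subtraction, where
    the default value would be \<infinity>.\<close>
  define Z where "Z = (\<lambda>\<omega>. if \<omega> \<in> A \<and> V' \<omega> < U' \<omega> then U' \<omega> - V' \<omega> else 0)"
  have Z: "Z \<in> borel_measurable M"
    unfolding Z_def by measurable
  have norm_Z: "norm1 Z \<le> 3 * ?u' n + 3 * ?v' n + 3 * (3 * ?u n + 3 * ?v n)" for n
  proof -
    have [measurable]: "E t (R n) \<in> borel_measurable M"
      using E_in_H[OF R] H_measurable by blast
    have "norm1 Z \<le> 3 * ?u' n + 3 * ?v' n + 3 * norm1 (\<lambda>\<omega>. ereal (E t (R n) \<omega>))"
    proof (intro norm1_triangle L1_limD(4)[OF Us'] L1_limD(4)[OF Vs'] quasi_surelyI)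
      fix \<omega> assume "\<omega> \<in> space M"
      show "\<bar>Z \<omega>\<bar> \<le> \<bar>U' \<omega> - ereal (E t (Us n) \<omega>)\<bar> + \<bar>V' \<omega> - ereal (E t (Vs n) \<omega>)\<bar>
        + \<bar>ereal (E t (R n) \<omega>)\<bar>"
      proof (cases "\<omega> \<in> A \<and> V' \<omega> < U' \<omega>")
        case True
        then have "\<bar>Z \<omega>\<bar> = U' \<omega> - V' \<omega>"
          by (cases "U' \<omega>"; cases "V' \<omega>") (auto simp: Z_def)
        then show ?thesis
          using ereal_gap_bound[OF _ E_le, of "V' \<omega>" "U' \<omega>" \<omega> n] True by simp
      qed (auto simp: Z_def)
    qed simp
    also have "\<dots> \<le> 3 * ?u' n + 3 * ?v' n + 3 * (3 * ?u n + 3 * ?v n)"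
      by (intro add_mono ereal_mult_left_mono norm_ER) auto
    finally show ?thesis .
  qed
  have "(\<lambda>n. ereal 3 * ?u' n + ereal 3 * ?v' n + ereal 3 * (ereal 3 * ?u n + ereal 3 * ?v n)) \<longlonglongrightarrow> 0"
    by (intro tendsto_add_zero_ereal tendsto_cmult_zero_ereal L1_limD(3) Us Vs Us' Vs')
  then have "norm1 Z \<le> 0"
    using norm_Z by (intro LIMSEQ_le_const) auto
  then have "quasi_surely (\<lambda>\<omega>. Z \<omega> = 0)"
    using norm1_nonneg[of Z] by (intro norm1_eq_zero_imp Z) simp
  then show ?thesis
  proof (rule quasi_surely_mono)
    fix \<omega> assume "Z \<omega> = 0"
    then show "\<omega> \<in> A \<longrightarrow> U' \<omega> \<le> V' \<omega>"
      by (cases "U' \<omega>"; cases "V' \<omega>") (auto simp: Z_def split: if_splits)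
  qed
qed

section \<open>Pasting elements of \<open>L1\<close> and stopping a process\<close>

text \<open>The approximants are pasted along \<open>A\<close> too; at each point the error is one
  of the two given errors, hence at most their sum.\<close>

lemma L1_if:
  assumes "U \<in> L1" "V \<in> L1" and A[measurable]: "A \<in> sets M"
  shows "(\<lambda>\<omega>. if \<omega> \<in> A then U \<omega> else V \<omega>) \<in> L1"
proof -
  obtain Us Vs where Us: "L1_lim Us U" and Vs: "L1_lim Vs V"
    using assms by (auto simp: L1_def)
  have [measurable]: "U \<in> borel_measurable M" "V \<in> borel_measurable M"
    using L1_limD(2) Us Vs by auto
  let ?W = "\<lambda>n \<omega>. indicator A \<omega> * Us n \<omega> + (Vs n \<omega> - indicator A \<omega> * Vs n \<omega>)"
  have "L1_lim ?W (\<lambda>\<omega>. if \<omega> \<in> A then U \<omega> else V \<omega>)"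
  proof (rule L1_limI)
    show "?W n \<in> H" for n
      by (rule H_add[OF H_indicator[OF L1_limD(1)[OF Us] A]
            H_diff[OF L1_limD(1)[OF Vs] H_indicator[OF L1_limD(1)[OF Vs] A]]])
    show "norm1 (\<lambda>\<omega>. (if \<omega> \<in> A then U \<omega> else V \<omega>) - ereal (?W n \<omega>))
      \<le> ereal 3 * norm1 (\<lambda>\<omega>. U \<omega> - ereal (Us n \<omega>)) + ereal 3 * norm1 (\<lambda>\<omega>. V \<omega> - ereal (Vs n \<omega>))" for n
    proof -
      have "\<bar>(if \<omega> \<in> A then U \<omega> else V \<omega>) - ereal (?W n \<omega>)\<bar>
          \<le> \<bar>U \<omega> - ereal (Us n \<omega>)\<bar> + \<bar>V \<omega> - ereal (Vs n \<omega>)\<bar>" for \<omega>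
        by (cases "\<omega> \<in> A") (simp_all add: add_increasing add_increasing2)
      from norm1_triangle2[OF L1_limD(4)[OF Us] L1_limD(4)[OF Vs] quasi_surelyI[OF this]]
      show ?thesis
        by simp
    qed
    show "(\<lambda>n. ereal 3 * norm1 (\<lambda>\<omega>. U \<omega> - ereal (Us n \<omega>))
      + ereal 3 * norm1 (\<lambda>\<omega>. V \<omega> - ereal (Vs n \<omega>))) \<longlonglongrightarrow> 0"
      by (intro tendsto_add_zero_ereal tendsto_cmult_zero_ereal L1_limD(3) Us Vs)
  qed measurable
  then show ?thesis
    by (auto simp: L1_def)
qed

lemma stopping_time_le_sets:
  assumes "stopping_time F T"
  shows "{\<omega> \<in> space M. T \<omega> \<le> t} \<in> sets (F t)"
  using stopping_timeD[OF assms, of t] unfolding pred_def space_F by simp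

text \<open>Induction on the truncation level of \<open>T\<close>: passing from \<open>n\<close> to
  \<open>Suc n\<close> changes the stopped value only where \<open>T\<close> exceeds
  \<open>n\<close>, and there it becomes \<open>X (Suc n)\<close>.\<close>

lemma L1_stopped:
  assumes X: "\<And>t. X t \<in> L1" and T: "stopping_time F T"
    and N: "\<And>\<omega>. \<omega> \<in> space M \<Longrightarrow> T \<omega> \<le> N"
  shows "(\<lambda>\<omega>. X (T \<omega>) \<omega>) \<in> L1"
proof -
  have "(\<lambda>\<omega>. X (min (T \<omega>) n) \<omega>) \<in> L1" for n
  proof (induction n)
    case (Suc n)
    let ?A = "{\<omega> \<in> space M. T \<omega> \<le> n}"
    let ?Y = "\<lambda>\<omega>. if \<omega> \<in> ?A then X (min (T \<omega>) n) \<omega> else X (Suc n) \<omega>"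
    have "?Y \<in> L1"
      using stopping_time_le_sets[OF T] sets_F_subset by (intro L1_if Suc X) blast
    then obtain Ys where "L1_lim Ys ?Y"
      by (auto simp: L1_def)
    \<comment> \<open>Off \<open>space M\<close> the set \<open>?A\<close> has no points, so the two
      functions may differ there; the limit is transferred on the sample space.\<close>
    from L1_lim_cong[OF this L1_limD(1)[OF this] refl]
    have "L1_lim Ys (\<lambda>\<omega>. X (min (T \<omega>) (Suc n)) \<omega>)"
      by (auto simp: min_def le_Suc_eq)
    then show ?case
      by (auto simp: L1_def)
  qed (simp add: X)
  then obtain Ys where "L1_lim Ys (\<lambda>\<omega>. X (min (T \<omega>) N) \<omega>)"
    by (auto simp: L1_def)
  from L1_lim_cong[OF this L1_limD(1)[OF this] refl]
  have "L1_lim Ys (\<lambda>\<omega>. X (T \<omega>) \<omega>)"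
    using N by (auto simp: min_def)
  then show ?thesis
    by (auto simp: L1_def)
qed

section \<open>Backward induction and optional stopping\<close>

lemma cond_expect_stopped_le:
  assumes X: "supermartingale X" and T: "stopping_time F T"
    and N: "\<And>\<omega>. \<omega> \<in> space M \<Longrightarrow> T \<omega> \<le> N" and "s \<le> Suc N"
  shows "quasi_surely (\<lambda>\<omega>. s \<le> T \<omega> \<longrightarrow> cond_expect s (\<lambda>\<omega>. X (T \<omega>) \<omega>) \<omega> \<le> X s \<omega>)"
  using \<open>s \<le> Suc N\<close>
proof (induction s rule: inc_induct)
  \<comment> \<open>At \<open>Suc N\<close>, one past the bound, no point of the sample space
    satisfies \<open>s \<le> T \<omega>\<close>.\<close>
  case base
  then show ?case
    using N by (intro quasi_surelyI) force
next
  case (step s)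
  let ?XT = "\<lambda>\<omega>. X (T \<omega>) \<omega>"
  have L1: "X t \<in> L1" for t
    using X by (auto simp: supermartingale_def)
  have XT: "?XT \<in> L1"
    by (rule L1_stopped[OF L1 T N])
  \<comment> \<open>The versions picked by \<open>cond_expect\<close> come from unrelated sequences,
    so the tower property is used for \<open>Y\<close> and \<open>Z\<close>, which share one
    sequence. Local monotonicity on the whole space then compares them with the picked
    versions.\<close>
  obtain Y Z where Y: "ce (Suc s) ?XT Y" and Z: "ce s ?XT Z" and YZ: "ce s Y Z"
    using ce_tower[OF XT, of s "Suc s"] by auto
  have "{\<omega> \<in> space M. T \<omega> \<le> s} \<in> sets (F s)" and space: "space M \<in> sets (F t)" for t
    using stopping_time_le_sets[OF T] sets.top[of "F t"] space_F by auto
  then have after: "space M - {\<omega> \<in> space M. T \<omega> \<le> s} \<in> sets (F s)" (is "?B \<in> _")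
    using sets.Diff by blast
  have at: "{\<omega> \<in> space M. T \<omega> = s} \<in> sets (F s)" (is "?A \<in> _")
  proof (cases s)
    case 0
    then show ?thesis
      using stopping_time_le_sets[OF T, of 0] by simp
  next
    case (Suc r)
    have "?A = {\<omega> \<in> space M. T \<omega> \<le> s} - {\<omega> \<in> space M. T \<omega> \<le> r}"
      using Suc by auto
    moreover have "{\<omega> \<in> space M. T \<omega> \<le> r} \<in> sets (F s)"
      using stopping_time_le_sets[OF T, of r] sets_F_mono[of r s] Suc by auto
    ultimately show ?thesis
      using stopping_time_le_sets[OF T, of s] by simp
  qed
  have super: "quasi_surely (\<lambda>\<omega>. cond_expect s (X t) \<omega> \<le> X s \<omega>)" if "s \<le> t" for t
    using X that by (auto simp: supermartingale_def)
  have "quasi_surely (\<lambda>\<omega>. \<omega> \<in> space M \<longrightarrow> Y \<omega> \<le> cond_expect (Suc s) ?XT \<omega>)"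
    by (rule ce_local_mono[OF Y ce_cond_expect[OF XT] space quasi_surelyI]) simp
  \<comment> \<open>On \<open>?B\<close> one has \<open>Suc s \<le> T \<omega>\<close>, so the
    induction hypothesis applies.\<close>
  from quasi_surely_conj[OF this step.IH]
  have "quasi_surely (\<lambda>\<omega>. \<omega> \<in> ?B \<longrightarrow> Y \<omega> \<le> X (Suc s) \<omega>)"
    by (rule quasi_surely_mono) (auto intro: order_trans)
  from ce_local_mono[OF YZ ce_cond_expect[OF L1] after this]
  have ZB: "quasi_surely (\<lambda>\<omega>. \<omega> \<in> ?B \<longrightarrow> Z \<omega> \<le> cond_expect s (X (Suc s)) \<omega>)" .
  \<comment> \<open>On \<open>?A\<close> the stopped value is \<open>X s\<close>, so local
    monotonicity compares their conditional expectations at time \<open>s\<close>.\<close>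
  have ZA: "quasi_surely (\<lambda>\<omega>. \<omega> \<in> ?A \<longrightarrow> Z \<omega> \<le> cond_expect s (X s) \<omega>)"
    by (rule ce_local_mono[OF Z ce_cond_expect[OF L1] at quasi_surelyI]) simp
  have "quasi_surely (\<lambda>\<omega>. \<omega> \<in> space M \<longrightarrow> cond_expect s ?XT \<omega> \<le> Z \<omega>)"
    by (rule ce_local_mono[OF ce_cond_expect[OF XT] Z space quasi_surelyI]) simp
  \<comment> \<open>Where \<open>s \<le> T \<omega>\<close>, the point lies in \<open>?A\<close> or
    \<open>?B\<close>; the bound on \<open>Z\<close> there combines with the supermartingale
    inequality for \<open>X s\<close> or \<open>X (Suc s)\<close>.\<close>
  from quasi_surely_conj[OF quasi_surely_conj[OF this quasi_surely_conj[OF ZA ZB]]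
      quasi_surely_conj[OF super[of s] super[of "Suc s"]]]
  show ?case
    by (rule quasi_surely_mono) (auto simp: not_le le_eq_less_or_eq intro: order_trans)
qed

end

theorem theorem4p2:
  fixes M :: "'a measure" and F :: "nat \<Rightarrow> 'a measure"
    and H :: "('a \<Rightarrow> real) set" and E :: "nat \<Rightarrow> ('a \<Rightarrow> real) \<Rightarrow> 'a \<Rightarrow> real"
    and X :: "nat \<Rightarrow> 'a \<Rightarrow> ereal" and S T :: "'a \<Rightarrow> nat"
  assumes "SL_expectation M F H E"
    and "SL_expectation.supermartingale M F H E X"
    and "stopping_time F S" and "bdd_above (S ` space M)"
    and "stopping_time F T" and "bdd_above (T ` space M)"
    and "\<forall>\<omega>\<in>space M. S \<omega> \<le> T \<omega>"
  shows "SL_expectation.quasi_surely M E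
    (\<lambda>\<omega>. X (S \<omega>) \<omega> \<ge> SL_expectation.cond_expect_at M H E S (\<lambda>\<omega>. X (T \<omega>) \<omega>) \<omega>)"
proof -
  interpret SL_expectation M F H E by fact
  obtain N where N: "\<And>\<omega>. \<omega> \<in> space M \<Longrightarrow> T \<omega> \<le> N"
    using assms(6) by (auto simp: bdd_above_def)
  let ?XT = "\<lambda>\<omega>. X (T \<omega>) \<omega>"
  \<comment> \<open>The exceptional sets of the finitely many times are merged first, so that the
    random index \<open>S \<omega>\<close> can be inserted outside one null set.\<close>
  have "quasi_surely (\<lambda>\<omega>. \<forall>s\<le>N. s \<le> T \<omega> \<longrightarrow> cond_expect s ?XT \<omega> \<le> X s \<omega>)"
    using assms(2,5) N by (intro quasi_surely_all_le cond_expect_stopped_le) auto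
  then show ?thesis
  proof (rule quasi_surely_mono)
    fix \<omega> assume \<omega>: "\<omega> \<in> space M"
      and le: "\<forall>s\<le>N. s \<le> T \<omega> \<longrightarrow> cond_expect s ?XT \<omega> \<le> X s \<omega>"
    have "S \<omega> \<le> T \<omega>" "S \<omega> \<le> N"
      using assms(7) \<omega> N[OF \<omega>] by (auto intro: order_trans)
    then show "cond_expect_at S ?XT \<omega> \<le> X (S \<omega>) \<omega>"
      using le by (simp add: cond_expect_at_def)
  qed
qed

end
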